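(* For every complete multipartite graph $H$ (connected, with at least three nodes, of constant size) that is neither a clique nor a star, the one-round bandwidth complexity of $\textsc{MemDetect}(H)$ under node insertions is $\Omega(n)$.
   Context: A graph is complete multipartite if its node set can be partitioned into independent sets such that two nodes are adjacent iff they lie in different parts; a star is $K_{1,s}$. Dynamic network model: a sequence of graphs $G^0, G^1, \ldots$ with $n$ nodes in total, each obtained from the previous by at most one node insertion (a new node adjacent to an arbitrary subset of existing nodes); nodes have distinct IDs from $[n]$, know their neighbors' IDs and initially the whole of $G^0$; communication is synchronous, each round the change happens first, then each node sends a $B$-bit message to each neighbor; nodes detect changes only via their neighbor lists; algorithms are deterministic. A one-round algorithm must output correctly for the current graph at the end of each round. The one-round bandwidth complexity is the minimum such $B$. $\textsc{MemDetect}(H)$: each node $v$ outputs whether $v$ belongs to some subgraph isomorphic to $H$. *)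

theory Defs
  imports Complex_Main "HOL-Library.Disjoint_Sets" "HOL-Library.Extended_Real"
begin

section \<open>Simple graphs\<close>

record 'a ugraph =
  verts :: "'a set"
  edges :: "'a set set"

definition simple_graph :: "'a ugraph \<Rightarrow> bool" where
  "simple_graph G \<longleftrightarrow> (\<forall>e\<in>edges G. e \<subseteq> verts G \<and> card e = 2)"

definition adj :: "'a ugraph \<Rightarrow> 'a \<Rightarrow> 'a \<Rightarrow> bool" where
  "adj G u v \<longleftrightarrow> {u, v} \<in> edges G"

definition nbrs :: "'a ugraph \<Rightarrow> 'a \<Rightarrow> 'a set" where
  "nbrs G v = {u. adj G v u}"

definition connected_graph :: "'a ugraph \<Rightarrow> bool" where
  "connected_graph G \<longleftrightarrow> (\<forall>u\<in>verts G. \<forall>v\<in>verts G. (adj G)\<^sup>*\<^sup>* u v)"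

text \<open>The case \<open>u, v \<in> X\<close> of the equivalence below says that every part \<open>X\<close> is independent.\<close>

definition complete_multipartite :: "'a ugraph \<Rightarrow> bool" where
  "complete_multipartite G \<longleftrightarrow>
     (\<exists>P. partition_on (verts G) P \<and>
          (\<forall>u\<in>verts G. \<forall>v\<in>verts G. adj G u v \<longleftrightarrow> \<not> (\<exists>X\<in>P. u \<in> X \<and> v \<in> X)))"

definition is_clique :: "'a ugraph \<Rightarrow> bool" where
  "is_clique G \<longleftrightarrow> (\<forall>u\<in>verts G. \<forall>v\<in>verts G. u \<noteq> v \<longrightarrow> adj G u v)"

definition is_star :: "'a ugraph \<Rightarrow> bool" where
  "is_star G \<longleftrightarrow> (\<exists>c\<in>verts G. edges G = {{c, v} | v. v \<in> verts G - {c}})"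

definition isomorphic :: "'a ugraph \<Rightarrow> 'b ugraph \<Rightarrow> bool" where
  "isomorphic G G' \<longleftrightarrow>
     (\<exists>f. bij_betw f (verts G) (verts G') \<and>
          (\<forall>u\<in>verts G. \<forall>v\<in>verts G. adj G u v \<longleftrightarrow> adj G' (f u) (f v)))"

text \<open>Subgraphs need not be induced.\<close>

definition subgraph :: "'a ugraph \<Rightarrow> 'a ugraph \<Rightarrow> bool" where
  "subgraph S G \<longleftrightarrow> simple_graph S \<and> verts S \<subseteq> verts G \<and> edges S \<subseteq> edges G"

definition mem_detect :: "'h ugraph \<Rightarrow> 'a ugraph \<Rightarrow> 'a \<Rightarrow> bool" where
  "mem_detect H G v \<longleftrightarrow> (\<exists>S. subgraph S G \<and> isomorphic H S \<and> v \<in> verts S)"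


section \<open>Dynamic networks under node insertions\<close>

text \<open>Nodes are identified with their IDs in \<open>{1..n}\<close>.\<close>

definition insert_node :: "'a \<Rightarrow> 'a set \<Rightarrow> 'a ugraph \<Rightarrow> 'a ugraph" where
  "insert_node v N G =
     \<lparr>verts = insert v (verts G), edges = edges G \<union> {{v, u} | u. u \<in> N}\<rparr>"

definition node_insertion_step :: "'a ugraph \<Rightarrow> 'a ugraph \<Rightarrow> bool" where
  "node_insertion_step G G' \<longleftrightarrow>
     G' = G \<or> (\<exists>v N. v \<notin> verts G \<and> N \<subseteq> verts G \<and> G' = insert_node v N G)"

definition node_insertion_network :: "nat \<Rightarrow> (nat \<Rightarrow> nat ugraph) \<Rightarrow> bool" where
  "node_insertion_network n G \<longleftrightarrow>
     simple_graph (G 0) \<and> (\<Union>i. verts (G i)) = {1..n} \<and>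
     (\<forall>i. node_insertion_step (G i) (G (Suc i)))"


section \<open>Deterministic distributed algorithms\<close>

type_synonym message = "bool list"

text \<open>
  The local view of a node lists, for every round in which the node has been present, its set of
  neighbours after the topology change of that round and the messages received from them.  Taking
  the whole view as the local state loses no generality, since local computation is unbounded
  and deterministic.  The first argument of both components is the initial graph, the second one
  the node's own ID.  \<open>send_msg A G\<^sub>0 v h N u\<close> is the message sent by \<open>v\<close> to \<open>u\<close> when \<open>h\<close> is
  the view of \<open>v\<close> up to the previous round and \<open>N\<close> is its current set of neighbours.
\<close>

type_synonym view = "(nat set \<times> (nat \<rightharpoonup> message)) list"

record algorithm =
  send_msg :: "nat ugraph \<Rightarrow> nat \<Rightarrow> view \<Rightarrow> nat set \<Rightarrow> nat \<Rightarrow> message"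
  out_bit :: "nat ugraph \<Rightarrow> nat \<Rightarrow> view \<Rightarrow> bool"

text \<open>
  \<open>view_after A G i v\<close> is the view of \<open>v\<close> at the end of round \<open>i\<close>.  Round \<open>i\<close> consists of the change
  from \<open>G (i - 1)\<close> to \<open>G i\<close> followed by communication along the edges of \<open>G i\<close>; no
  communication takes place before the first change.
\<close>

primrec view_after :: "algorithm \<Rightarrow> (nat \<Rightarrow> nat ugraph) \<Rightarrow> nat \<Rightarrow> nat \<Rightarrow> view" where
  "view_after A G 0 = (\<lambda>v. [])"
| "view_after A G (Suc i) =
     (\<lambda>v. if v \<in> verts (G (Suc i)) then
            view_after A G i v @
              [(nbrs (G (Suc i)) v,
                \<lambda>u. if u \<in> nbrs (G (Suc i)) v
                    then Some (send_msg A (G 0) u (view_after A G i u) (nbrs (G (Suc i)) u) v)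
                    else None)]
          else [])"

definition has_bandwidth :: "algorithm \<Rightarrow> nat \<Rightarrow> bool" where
  "has_bandwidth A B \<longleftrightarrow> (\<forall>G\<^sub>0 v h N u. length (send_msg A G\<^sub>0 v h N u) = B)"

text \<open>The problem \<open>P\<close> prescribes the output \<open>P G v\<close> of node \<open>v\<close> when the current graph is \<open>G\<close>.\<close>

definition one_round_solves ::
  "nat \<Rightarrow> algorithm \<Rightarrow> (nat ugraph \<Rightarrow> nat \<Rightarrow> bool) \<Rightarrow> bool" where
  "one_round_solves n A P \<longleftrightarrow>
     (\<forall>G. node_insertion_network n G \<longrightarrow>
        (\<forall>i\<ge>1. \<forall>v\<in>verts (G i). out_bit A (G 0) v (view_after A G i v) \<longleftrightarrow> P (G i) v))"

text \<open>
  The algorithm may depend on \<open>n\<close>.  The value is \<open>\<infinity>\<close> if no bandwidth suffices.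
\<close>

definition one_round_bandwidth :: "nat \<Rightarrow> (nat ugraph \<Rightarrow> nat \<Rightarrow> bool) \<Rightarrow> enat" where
  "one_round_bandwidth n P =
     Inf {enat B | B. \<exists>A. has_bandwidth A B \<and> one_round_solves n A P}"

end

theory Submission
  imports Defs
begin

text \<open>
  Let \<open>X\<close> be a largest part of \<open>H\<close> and \<open>C\<close> the rest; since \<open>H\<close> is neither a clique nor a star,
  both have at least two nodes.  Fix \<open>x\<^sub>0 \<noteq> y\<^sub>0\<close> in \<open>X\<close> and \<open>a \<noteq> b\<close> in \<open>C\<close>, and replace \<open>y\<^sub>0\<close> by a
  set \<open>Y\<close> of \<open>n - |H| + 1\<close> twins.  Node \<open>a\<close> is inserted first, adjacent within \<open>Y\<close> to an arbitrary
  subset \<open>S\<close>; then \<open>b\<close> is inserted, adjacent within \<open>Y\<close> to a single node \<open>j\<close>.  If \<open>j \<in> S\<close>, then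
  \<open>j\<close> completes a copy of \<open>H\<close> through \<open>x\<^sub>0\<close>.  Otherwise every node of \<open>Y\<close> has degree less than
  \<open>|C|\<close>, the minimum degree of \<open>H\<close>, and too few nodes remain for a copy of \<open>H\<close>.  Node \<open>x\<^sub>0\<close> is not
  adjacent to \<open>Y\<close>, so all it learns about \<open>S\<close> is contained in \<open>|C|\<close> messages that do not depend on
  \<open>j\<close>.  As these must determine \<open>S\<close>, we get \<open>|Y| \<le> |C| B\<close>.
\<close>

section \<open>Elementary facts on graphs and node insertion\<close>

lemma adj_commute: "adj G u v \<longleftrightarrow> adj G v u"
  by (simp add: adj_def insert_commute)

lemma simple_graph_adjD:
  assumes "simple_graph G" "adj G u v"
  shows "u \<in> verts G" "v \<in> verts G" "u \<noteq> v"
  using assms by (auto simp: simple_graph_def adj_def)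

lemma nbrs_subset_verts: "simple_graph G \<Longrightarrow> nbrs G v \<subseteq> verts G"
  by (auto simp: nbrs_def dest: simple_graph_adjD)

lemma verts_insert_node [simp]: "verts (insert_node v N G) = insert v (verts G)"
  by (simp add: insert_node_def)

lemma adj_insert_node:
  "adj (insert_node v N G) x y \<longleftrightarrow> adj G x y \<or> x = v \<and> y \<in> N \<or> y = v \<and> x \<in> N"
  by (auto simp: adj_def insert_node_def doubleton_eq_iff)

lemma nbrs_insert_node:
  "nbrs (insert_node v N G) x =
     nbrs G x \<union> (if x = v then N else {}) \<union> (if x \<in> N then {v} else {})"
  by (auto simp: nbrs_def adj_insert_node)

text \<open>Neighbours of \<open>w\<close> are mapped to distinct neighbours of \<open>f w\<close>,
  as edges of \<open>S\<close> are edges of \<open>G\<close>. Finiteness matters because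
  \<open>card\<close> of an infinite set is 0.\<close>

lemma degree_mono_subgraph_iso:
  assumes H: "simple_graph H" and sub: "subgraph S G" and fin: "finite (nbrs G (f w))"
    and bij: "bij_betw f (verts H) (verts S)"
    and iso: "\<forall>u\<in>verts H. \<forall>v\<in>verts H. adj H u v \<longleftrightarrow> adj S (f u) (f v)"
    and w: "w \<in> verts H"
  shows "card (nbrs H w) \<le> card (nbrs G (f w))"
proof (rule card_inj_on_le[OF _ _ fin])
  have nb: "nbrs H w \<subseteq> verts H" using nbrs_subset_verts[OF H] .
  show "inj_on f (nbrs H w)" using bij nb by (meson bij_betw_def inj_on_subset)
  have "adj G (f w) (f u)" if "adj H w u" for u
  proof -
    have "adj S (f w) (f u)" using iso w simple_graph_adjD(2)[OF H that] that by blast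
    then show ?thesis using sub by (auto simp: subgraph_def adj_def)
  qed
  then show "f ` nbrs H w \<subseteq> nbrs G (f w)" by (auto simp: nbrs_def)
qed

section \<open>Structure of the pattern graph\<close>

text \<open>Neighbourhoods are complements of parts, so a largest part \<open>X\<close> realises the
  minimum degree. A missing edge forces a part with two nodes; connectivity excludes an empty
  complement of \<open>X\<close>, and a one-node complement would make \<open>H\<close> a
  star.\<close>

lemma complete_multipartite_largest_part:
  fixes H :: "'h ugraph"
  assumes H: "simple_graph H" and fin: "finite (verts H)" and conn: "connected_graph H"
    and card3: "card (verts H) \<ge> 3" and cm: "complete_multipartite H"
    and nclique: "\<not> is_clique H" and nstar: "\<not> is_star H"
  obtains X where "X \<subseteq> verts H" "card X \<ge> 2" "card (verts H - X) \<ge> 2"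
    "\<And>u. u \<in> X \<Longrightarrow> nbrs H u = verts H - X"
    "\<And>w. w \<in> verts H \<Longrightarrow> card (verts H - X) \<le> card (nbrs H w)"
proof -
  let ?V = "verts H"
  obtain P where P: "partition_on ?V P"
    and adj: "\<forall>u\<in>?V. \<forall>v\<in>?V. adj H u v \<longleftrightarrow> \<not> (\<exists>X\<in>P. u \<in> X \<and> v \<in> X)"
    using cm by (auto simp: complete_multipartite_def)
  have finP: "finite P" using P fin by (metis finite_elements)
  have sub: "Z \<subseteq> ?V" if "Z \<in> P" for Z using P that by (auto simp: partition_on_def)
  have nb: "nbrs H u = ?V - Z" if "u \<in> Z" "Z \<in> P" for u Z
  proof -
    have "u \<in> Z' \<longleftrightarrow> Z' = Z" if "Z' \<in> P" for Z'
      using P that \<open>u \<in> Z\<close> \<open>Z \<in> P\<close> by (auto simp: partition_on_def disjoint_def)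
    then have "adj H u v \<longleftrightarrow> v \<notin> Z" if "v \<in> ?V" for v
      using adj that sub[OF \<open>Z \<in> P\<close>] \<open>u \<in> Z\<close> \<open>Z \<in> P\<close> by blast
    then show ?thesis using simple_graph_adjD(2)[OF H] by (auto simp: nbrs_def)
  qed
  obtain p q where pq: "p \<in> ?V" "q \<in> ?V" "p \<noteq> q" "\<not> adj H p q"
    using nclique by (auto simp: is_clique_def)
  then obtain Z where Z: "Z \<in> P" "p \<in> Z" "q \<in> Z" using adj by blast
  have "card {p, q} \<le> card Z"
    using Z sub[OF Z(1)] fin by (intro card_mono) (auto intro: finite_subset)
  then have Z2: "card Z \<ge> 2" using pq by simp
  have "Max (card ` P) \<in> card ` P" using finP Z by (intro Max_in) auto
  then obtain X where X: "X \<in> P" "card X = Max (card ` P)" by auto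
  have max: "card W \<le> card X" if "W \<in> P" for W using that finP X by simp
  have XV: "X \<subseteq> ?V" using sub X by simp
  have finX: "finite X" using XV fin finite_subset by blast
  have X2: "card X \<ge> 2" using max[OF Z(1)] Z2 by simp
  have "card (?V - X) \<noteq> 0"
  proof
    assume "card (?V - X) = 0"
    then have "X = ?V" using fin XV by auto
    then have noedge: "\<not> adj H p u" for u
      using nb[OF _ X(1)] pq(1) by (auto simp: nbrs_def)
    have "(adj H)\<^sup>*\<^sup>* p q" using conn pq by (auto simp: connected_graph_def)
    then show False using noedge pq(3) by (meson converse_rtranclpE)
  qed
  moreover have "card (?V - X) \<noteq> 1"
  proof
    assume "card (?V - X) = 1"
    then obtain z where z: "?V - X = {z}" by (auto simp: card_1_singleton_iff)
    have zV: "z \<in> ?V" and zX: "z \<notin> X" using z by auto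
    have others: "v \<in> X \<longleftrightarrow> v \<in> ?V - {z}" for v using z XV by auto
    have X_adj: "adj H v u \<longleftrightarrow> u = z" if "v \<in> X" for u v
      using nb[OF that X(1)] z by (auto simp: nbrs_def)
    have "edges H = {{z, v} | v. v \<in> ?V - {z}}" (is "_ = ?E")
    proof (intro equalityI subsetI)
      fix e assume e: "e \<in> edges H"
      then obtain u v where uv: "e = {u, v}" "u \<noteq> v"
        using H by (auto simp: simple_graph_def card_2_iff)
      then have a: "adj H u v" "adj H v u" using e by (auto simp: adj_def insert_commute)
      have "u \<in> ?V" "v \<in> ?V" using simple_graph_adjD[OF H a(1)] by auto
      \<comment> \<open>If \<open>u\<close> is not the centre \<open>z\<close>, it lies in
        \<open>X\<close>, where \<open>z\<close> is the only neighbour.\<close>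
      then consider "u = z" "v \<in> ?V - {z}" | "u \<in> X" using others uv(2) by blast
      then show "e \<in> ?E"
      proof cases
        case 1 then show ?thesis using uv by auto
      next
        case 2
        then show ?thesis using X_adj[OF 2] a(1) uv others by (auto simp: insert_commute)
      qed
    next
      fix e assume "e \<in> ?E"
      then obtain v where "e = {z, v}" "v \<in> X" using others by blast
      then show "e \<in> edges H" using X_adj[of v z] by (simp add: adj_def insert_commute)
    qed
    then show False using nstar zV by (auto simp: is_star_def)
  qed
  ultimately have C2: "card (?V - X) \<ge> 2" by simp
  have deg: "card (?V - X) \<le> card (nbrs H w)" if "w \<in> ?V" for w
  proof -
    obtain W where W: "W \<in> P" "w \<in> W" using partition_onD1[OF P] \<open>w \<in> ?V\<close> by auto
    have "finite W" using sub[OF W(1)] fin finite_subset by blast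
    then show ?thesis
      using nb[OF W(2,1)] max[OF W(1)] sub[OF W(1)] XV finX by (simp add: card_Diff_subset)
  qed
  show thesis using that[OF XV X2 C2 nb[OF _ X(1)] deg] .
qed

section \<open>The hard family of networks\<close>

text \<open>
  The embedding \<open>g\<close> gives the nodes of \<open>H\<close> their IDs; all remaining IDs become twins of \<open>y\<^sub>0\<close>, which
  the retraction \<open>r\<close> expresses.
\<close>

locale twin_construction =
  fixes H :: "'h ugraph" and X :: "'h set" and x\<^sub>0 y\<^sub>0 a b :: 'h and g :: "'h \<Rightarrow> nat" and n :: nat
  assumes H: "simple_graph H" and finite_H: "finite (verts H)"
    and X: "X \<subseteq> verts H"
    and x0: "x\<^sub>0 \<in> X" and y0: "y\<^sub>0 \<in> X" and x0_neq_y0: "x\<^sub>0 \<noteq> y\<^sub>0"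
    and a: "a \<in> verts H - X" and b: "b \<in> verts H - X" and a_neq_b: "a \<noteq> b"
    and nbrs_X: "u \<in> X \<Longrightarrow> nbrs H u = verts H - X"
    and min_degree: "w \<in> verts H \<Longrightarrow> card (verts H - X) \<le> card (nbrs H w)"
    and inj_g: "inj_on g (verts H)" and g_range: "g ` verts H \<subseteq> {1..n}"
begin

definition r :: "nat \<Rightarrow> 'h" where
  "r i = (if i \<in> g ` verts H then inv_into (verts H) g i else y\<^sub>0)"

definition Y :: "nat set" where "Y = {i \<in> {1..n}. r i = y\<^sub>0}"

definition K :: "nat set" where "K = g ` (verts H - X)"

text \<open>Pulling adjacency back along \<open>r\<close> gives the blow-up of \<open>H\<close> at
  \<open>y\<^sub>0\<close>; \<open>a\<close> and \<open>b\<close> are left out because they arrive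
  later.\<close>

definition G\<^sub>0 :: "nat ugraph" where
  "G\<^sub>0 = \<lparr>verts = {1..n} - {g a, g b},
         edges = {{i, j} | i j. i \<in> {1..n} - {g a, g b} \<and> j \<in> {1..n} - {g a, g b} \<and>
                                adj H (r i) (r j)}\<rparr>"

text \<open>Only the twins encode \<open>S\<close>: to every other node present, \<open>a\<close> is
  joined as in \<open>H\<close>. The node \<open>g b\<close> is absent at this stage.\<close>

definition N\<^sub>a :: "nat set \<Rightarrow> nat set" where
  "N\<^sub>a S = {i \<in> {1..n} - {g a, g b}. adj H a (r i) \<and> (i \<in> Y \<longrightarrow> i \<in> S)}"

definition N\<^sub>b :: "nat \<Rightarrow> nat set" where
  "N\<^sub>b j = {i \<in> {1..n} - {g b}. adj H b (r i) \<and> (i \<in> Y \<longrightarrow> i = j)}"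

definition G\<^sub>1 :: "nat set \<Rightarrow> nat ugraph" where
  "G\<^sub>1 S = insert_node (g a) (N\<^sub>a S) G\<^sub>0"

definition G\<^sub>2 :: "nat set \<Rightarrow> nat \<Rightarrow> nat ugraph" where
  "G\<^sub>2 S j = insert_node (g b) (N\<^sub>b j) (G\<^sub>1 S)"

definition net :: "nat set \<Rightarrow> nat \<Rightarrow> nat \<Rightarrow> nat ugraph" where
  "net S j i = (if i = 0 then G\<^sub>0 else if i = 1 then G\<^sub>1 S else G\<^sub>2 S j)"

lemma r_g [simp]: "v \<in> verts H \<Longrightarrow> r (g v) = v"
  using inj_g by (simp add: r_def)

lemma g_in [simp]: "v \<in> verts H \<Longrightarrow> g v \<in> {1..n}"
  using g_range by blast

text \<open>IDs outside the image of \<open>g\<close> all go to \<open>y\<^sub>0\<close>, so the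
  other fibres of \<open>r\<close> are singletons.\<close>

lemma g_r: "r i \<noteq> y\<^sub>0 \<Longrightarrow> g (r i) = i"
  by (auto simp: r_def f_inv_into_f split: if_splits)

lemma r_in [simp]: "r i \<in> verts H"
  using X y0 by (auto simp: r_def inv_into_into)

lemma in_verts [simp]: "x\<^sub>0 \<in> verts H" "y\<^sub>0 \<in> verts H" "a \<in> verts H" "b \<in> verts H"
  using X x0 y0 a b by auto

lemma ab_neq [simp]:
  "a \<noteq> y\<^sub>0" "b \<noteq> y\<^sub>0" "a \<noteq> x\<^sub>0" "b \<noteq> x\<^sub>0" "x\<^sub>0 \<noteq> a" "x\<^sub>0 \<noteq> b" "a \<noteq> b" "b \<noteq> a"
  using x0 y0 a b a_neq_b by auto

lemma g_eq [simp]: "u \<in> verts H \<Longrightarrow> v \<in> verts H \<Longrightarrow> g u = g v \<longleftrightarrow> u = v"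
  using inj_g by (auto dest: inj_onD)

lemma g_notin_Y: "v \<in> verts H \<Longrightarrow> v \<noteq> y\<^sub>0 \<Longrightarrow> g v \<notin> Y"
  by (simp add: Y_def)

lemma complement_Y: "{1..n} - Y = g ` (verts H - {y\<^sub>0})"
proof (intro equalityI subsetI)
  fix i assume "i \<in> {1..n} - Y"
  then have "g (r i) = i" "r i \<noteq> y\<^sub>0" using g_r by (auto simp: Y_def)
  then show "i \<in> g ` (verts H - {y\<^sub>0})" by (metis Diff_iff image_eqI r_in singletonD)
next
  fix i assume "i \<in> g ` (verts H - {y\<^sub>0})"
  then show "i \<in> {1..n} - Y" using g_in g_notin_Y by blast
qed

lemma card_complement_Y: "card ({1..n} - Y) = card (verts H) - 1"
proof -
  have "inj_on g (verts H - {y\<^sub>0})" using inj_g inj_on_subset by blast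
  then show ?thesis unfolding complement_Y using finite_H by (simp add: card_image)
qed

lemma card_Y: "n + 1 = card Y + card (verts H)"
proof -
  have "card Y \<le> n" using card_mono[of "{1..n}" Y] by (simp add: Y_def subset_eq)
  moreover have "card ({1..n} - Y) = n - card Y"
    by (subst card_Diff_subset) (auto simp: Y_def)
  moreover have "card (verts H) \<noteq> 0" using finite_H in_verts(1) by (metis card_eq_0_iff empty_iff)
  ultimately show ?thesis using card_complement_Y by linarith
qed

lemma adj_G0:
  "adj G\<^sub>0 i j \<longleftrightarrow> i \<in> {1..n} - {g a, g b} \<and> j \<in> {1..n} - {g a, g b} \<and> adj H (r i) (r j)"
  unfolding adj_def[of "G\<^sub>0"] using adj_commute[of H] by (auto simp: G\<^sub>0_def doubleton_eq_iff)

lemma verts_G: "verts (G\<^sub>1 S) = {1..n} - {g b}" "verts (G\<^sub>2 S j) = {1..n}"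
  using g_in[of a] g_in[of b] by (auto simp: G\<^sub>1_def G\<^sub>2_def G\<^sub>0_def)

lemma network: "node_insertion_network n (net S j)"
proof -
  have "card {u, v} = 2" if "adj H (r u) (r v)" for u v
    using simple_graph_adjD(3)[OF H that] by (cases "u = v") auto
  then have "simple_graph G\<^sub>0" by (auto simp: simple_graph_def G\<^sub>0_def)
  moreover have "(\<Union>i. verts (net S j i)) = {1..n}"
  proof (intro equalityI subsetI)
    fix v assume "v \<in> {1..n}"
    then have "v \<in> verts (net S j 2)" by (simp add: net_def verts_G)
    then show "v \<in> (\<Union>i. verts (net S j i))" by blast
  qed (auto simp: net_def verts_G G\<^sub>0_def split: if_splits)
  moreover have "node_insertion_step (net S j i) (net S j (Suc i))" for i
  proof -
    consider "i = 0" | "i = 1" | "i > 1" by linarith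
    then show ?thesis
    proof cases
      case 1
      have "g a \<notin> verts G\<^sub>0" "N\<^sub>a S \<subseteq> verts G\<^sub>0" by (auto simp: G\<^sub>0_def N\<^sub>a_def)
      then show ?thesis using 1 by (auto simp: node_insertion_step_def net_def G\<^sub>1_def)
    next
      case 2
      have "g b \<notin> verts (G\<^sub>1 S)" "N\<^sub>b j \<subseteq> verts (G\<^sub>1 S)" by (auto simp: verts_G N\<^sub>b_def)
      then show ?thesis using 2 by (auto simp: node_insertion_step_def net_def G\<^sub>2_def)
    next
      case 3
      then show ?thesis by (simp add: node_insertion_step_def net_def)
    qed
  qed
  ultimately show ?thesis by (simp add: node_insertion_network_def net_def)
qed

text \<open>The last graph lacks only those blow-up edges that join \<open>g a\<close> to twins
  outside \<open>S\<close>, or \<open>g b\<close> to twins other than \<open>j\<close>. Unordered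
  pairs in the hypotheses cover both orientations; the cases follow the stage at which the edge
  appears.\<close>

lemma adj_G2I:
  assumes ij: "i \<in> {1..n}" "k \<in> {1..n}" and adj: "adj H (r i) (r k)"
    and a: "\<And>y. {i, k} = {g a, y} \<Longrightarrow> y \<in> Y \<Longrightarrow> y \<in> S"
    and b: "\<And>y. {i, k} = {g b, y} \<Longrightarrow> y \<in> Y \<Longrightarrow> y = j"
  shows "adj (G\<^sub>2 S j) i k"
proof -
  have adj': "adj H (r k) (r i)" using adj adj_commute by metis
  have "i \<noteq> k" using simple_graph_adjD(3)[OF H adj] by auto
  consider "i = g b" | "k = g b" | "i \<noteq> g b" "k \<noteq> g b" "i = g a"
    | "i \<noteq> g b" "k \<noteq> g b" "k = g a" | "i \<notin> {g a, g b}" "k \<notin> {g a, g b}" by blast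
  then show ?thesis
  proof cases
    case 1
    then have "k \<in> N\<^sub>b j" using ij adj b[of k] \<open>i \<noteq> k\<close> by (auto simp: N\<^sub>b_def)
    then show ?thesis using 1 by (simp add: G\<^sub>2_def adj_insert_node)
  next
    case 2
    then have "i \<in> N\<^sub>b j" using ij adj' b[of i] \<open>i \<noteq> k\<close> by (auto simp: N\<^sub>b_def)
    then show ?thesis using 2 by (simp add: G\<^sub>2_def adj_insert_node)
  next
    case 3
    then have "k \<in> N\<^sub>a S" using ij adj a[of k] \<open>i \<noteq> k\<close> by (auto simp: N\<^sub>a_def)
    then show ?thesis using 3 by (simp add: G\<^sub>2_def G\<^sub>1_def adj_insert_node)
  next
    case 4
    then have "i \<in> N\<^sub>a S" using ij adj' a[of i] \<open>i \<noteq> k\<close> by (auto simp: N\<^sub>a_def)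
    then show ?thesis using 4 by (simp add: G\<^sub>2_def G\<^sub>1_def adj_insert_node)
  next
    case 5
    then show ?thesis using ij adj by (simp add: G\<^sub>2_def G\<^sub>1_def adj_insert_node adj_G0)
  qed
qed

section \<open>Membership in a copy of the pattern decides whether \<open>j\<close> is in
  \<open>S\<close>\<close>

text \<open>Letting \<open>j\<close> play the role of \<open>y\<^sub>0\<close> embeds
  \<open>H\<close>: \<open>S\<close> supplies the edge to \<open>a\<close>, and
  \<open>N\<^sub>b j\<close> the edge to \<open>b\<close>. The retraction \<open>r\<close> is a left
  inverse of this embedding.\<close>

lemma mem_detect_pos:
  assumes j: "j \<in> Y" "j \<in> S"
  shows "mem_detect H (G\<^sub>2 S j) (g x\<^sub>0)"
proof -
  define \<phi> where "\<phi> = g(y\<^sub>0 := j)"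
  have r\<phi>: "r (\<phi> v) = v" if "v \<in> verts H" for v
    using that j by (auto simp: \<phi>_def Y_def)
  have \<phi>_in: "\<phi> v \<in> {1..n}" if "v \<in> verts H" for v
    using that j g_in by (auto simp: \<phi>_def Y_def)
  have \<phi>_Y: "\<phi> v = j" if "\<phi> v \<in> Y" "v \<in> verts H" for v
    using that g_notin_Y by (auto simp: \<phi>_def split: if_splits)
  have inj: "inj_on \<phi> (verts H)" by (metis inj_onI r\<phi>)
  define T where "T = \<lparr>verts = \<phi> ` verts H, edges = {{\<phi> u, \<phi> v} | u v. adj H u v}\<rparr>"
  have adjV: "u \<in> verts H" "v \<in> verts H" "u \<noteq> v" if "adj H u v" for u v
    using simple_graph_adjD[OF H that] by auto
  have G2: "adj (G\<^sub>2 S j) (\<phi> u) (\<phi> v)" if "adj H u v" for u v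
  proof (rule adj_G2I)
    show "\<phi> u \<in> {1..n}" "\<phi> v \<in> {1..n}" using adjV[OF that] \<phi>_in by auto
    show "adj H (r (\<phi> u)) (r (\<phi> v))" using adjV[OF that] r\<phi> that by simp
    \<comment> \<open>The image meets \<open>Y\<close> only in \<open>j\<close>, so both side
      conditions of \<open>adj_G2I\<close> reduce to this.\<close>
    have eq_j: "y = j" if "{\<phi> u, \<phi> v} = {w, y}" "y \<in> Y" for w y
      using \<phi>_Y adjV(1,2)[OF \<open>adj H u v\<close>] that by (metis doubleton_eq_iff)
    then show "\<And>y. {\<phi> u, \<phi> v} = {g b, y} \<Longrightarrow> y \<in> Y \<Longrightarrow> y = j" by blast
    show "\<And>y. {\<phi> u, \<phi> v} = {g a, y} \<Longrightarrow> y \<in> Y \<Longrightarrow> y \<in> S" using eq_j j(2) by blast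
  qed
  have "card {\<phi> u, \<phi> v} = 2" if "adj H u v" for u v
    using adjV[OF that] inj_on_eq_iff[OF inj, of u v] by simp
  then have "simple_graph T"
    using adjV by (auto simp: T_def simple_graph_def)
  moreover have "verts T \<subseteq> verts (G\<^sub>2 S j)" using \<phi>_in by (auto simp: T_def verts_G)
  moreover have "edges T \<subseteq> edges (G\<^sub>2 S j)" using G2 by (auto simp: T_def adj_def)
  ultimately have "subgraph T (G\<^sub>2 S j)" by (simp add: subgraph_def)
  moreover have "isomorphic H T"
    unfolding isomorphic_def
  proof (intro exI conjI ballI)
    show "bij_betw \<phi> (verts H) (verts T)" using inj by (simp add: T_def bij_betw_def)
    fix u v assume uv: "u \<in> verts H" "v \<in> verts H"
    show "adj H u v \<longleftrightarrow> adj T (\<phi> u) (\<phi> v)"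
    proof
      assume "adj T (\<phi> u) (\<phi> v)"
      then obtain u' v' where "{\<phi> u, \<phi> v} = {\<phi> u', \<phi> v'}" and a': "adj H u' v'"
        by (auto simp: adj_def T_def)
      then have "u = u' \<and> v = v' \<or> u = v' \<and> v = u'"
        using uv adjV(1,2)[OF a'] r\<phi> by (metis doubleton_eq_iff)
      then show "adj H u v" using a' adj_commute by metis
    qed (auto simp: adj_def T_def)
  qed
  moreover have "g x\<^sub>0 \<in> verts T" using x0_neq_y0 by (auto simp: T_def \<phi>_def)
  ultimately show ?thesis by (auto simp: mem_detect_def)
qed

text \<open>Every twin has its neighbours in \<open>K\<close> and misses one of \<open>g a\<close>,
  \<open>g b\<close>, so its degree is below the minimum degree of \<open>H\<close>. A copy of
  \<open>H\<close> would thus avoid \<open>Y\<close>, leaving one node too few.\<close>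

lemma mem_detect_neg:
  assumes j: "j \<notin> S"
  shows "\<not> mem_detect H (G\<^sub>2 S j) v"
proof
  assume "mem_detect H (G\<^sub>2 S j) v"
  then obtain T f where T: "subgraph T (G\<^sub>2 S j)" and f: "bij_betw f (verts H) (verts T)"
    and iso: "\<forall>u\<in>verts H. \<forall>v\<in>verts H. adj H u v \<longleftrightarrow> adj T (f u) (f v)"
    by (auto simp: mem_detect_def isomorphic_def)
  have cardK: "card K = card (verts H - X)"
    unfolding K_def by (intro card_image) (meson Diff_subset inj_g inj_on_subset)
  have finK: "finite K" using finite_H by (simp add: K_def)
  have gK: "g a \<in> K" "g b \<in> K" using a b by (auto simp: K_def)
  have deg_Y: "card (nbrs (G\<^sub>2 S j) i) < card (verts H - X) \<and> finite (nbrs (G\<^sub>2 S j) i)"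
    if i: "i \<in> Y" for i
  proof -
    have ri: "r i = y\<^sub>0" using i by (simp add: Y_def)
    have ne: "i \<noteq> g a" "i \<noteq> g b" using ri by auto
    have "k \<in> K" if "adj H (r i) (r k)" for k
    proof -
      have "r k \<in> verts H - X" using nbrs_X[OF y0] that ri by (auto simp: nbrs_def)
      moreover from this have "g (r k) = k" using y0 by (intro g_r) auto
      ultimately show ?thesis unfolding K_def by (metis image_eqI)
    qed
    \<comment> \<open>The twin \<open>j\<close> misses \<open>g a\<close> because \<open>j\<close>
      is not in \<open>S\<close>; any other twin misses \<open>g b\<close>.\<close>
    then have "nbrs (G\<^sub>2 S j) i \<subseteq> (if i = j then K - {g a} else K - {g b})"
      using ne gK i j by (auto simp: nbrs_def G\<^sub>2_def G\<^sub>1_def adj_insert_node adj_G0 N\<^sub>a_def N\<^sub>b_def)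
    also have "\<dots> \<subset> K" using gK by auto
    finally show ?thesis using psubset_card_mono[OF finK] cardK finK
      by (metis finite_subset psubset_imp_subset)
  qed
  have "f w \<in> {1..n} - Y" if w: "w \<in> verts H" for w
  proof -
    have "f w \<notin> Y"
    proof
      assume "f w \<in> Y"
      then have "card (nbrs (G\<^sub>2 S j) (f w)) < card (verts H - X)" "finite (nbrs (G\<^sub>2 S j) (f w))"
        using deg_Y by auto
      then show False
        using degree_mono_subgraph_iso[OF H T _ f iso w] min_degree[OF w] by linarith
    qed
    moreover have "f w \<in> {1..n}" using w f T bij_betwE verts_G by (fastforce simp: subgraph_def)
    ultimately show ?thesis by simp
  qed
  moreover have "inj_on f (verts H)" using f by (simp add: bij_betw_def)
  ultimately have "card (verts H) \<le> card ({1..n} - Y)"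
    by (intro card_inj_on_le[of f]) auto
  moreover have "card (verts H) \<noteq> 0" using finite_H in_verts(1) by (metis card_eq_0_iff empty_iff)
  ultimately show False using card_complement_Y by linarith
qed

section \<open>What \<open>x\<^sub>0\<close> learns in two rounds\<close>

lemma K_notin_Y: "u \<in> K \<Longrightarrow> u \<notin> Y"
  using y0 g_notin_Y by (auto simp: K_def)

text \<open>As \<open>x\<^sub>0\<close> lies in the same part as \<open>y\<^sub>0\<close>, it is
  adjacent to no twin, and its neighbour lists reveal neither \<open>S\<close> nor
  \<open>j\<close>.\<close>

lemma nbrs_x0: "nbrs (G\<^sub>2 S j) (g x\<^sub>0) = K" "nbrs (G\<^sub>1 S) (g x\<^sub>0) = K - {g b}"
proof -
  have x0_adj: "adj H x\<^sub>0 v \<longleftrightarrow> v \<in> verts H - X" for v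
    using nbrs_X[OF x0] by (auto simp: nbrs_def)
  have x0_adj': "adj H v x\<^sub>0 \<longleftrightarrow> v \<in> verts H - X" for v
    using x0_adj adj_commute by metis
  have rK: "r i \<notin> X \<longleftrightarrow> i \<in> K" for i
  proof
    assume "r i \<notin> X"
    moreover from this have "g (r i) = i" using y0 by (intro g_r) auto
    ultimately show "i \<in> K" unfolding K_def by (metis Diff_iff image_eqI r_in)
  next
    assume "i \<in> K"
    then show "r i \<notin> X" by (auto simp: K_def)
  qed
  have K: "i \<in> {1..n}" if "i \<in> K" for i using that g_in by (auto simp: K_def)
  have gK: "g a \<in> K" "g b \<in> K" using a b by (auto simp: K_def)
  have x0Y: "g x\<^sub>0 \<notin> Y" using g_notin_Y x0_neq_y0 by simp
  have x0_in: "g x\<^sub>0 \<in> {1..n} - {g a, g b}" using g_in[of "x\<^sub>0"] by simp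
  have nbrs_G0: "nbrs G\<^sub>0 (g x\<^sub>0) = K - {g a, g b}"
    using x0_in K rK by (auto simp: nbrs_def adj_G0 x0_adj)
  have "g x\<^sub>0 \<in> N\<^sub>a S" using x0_in a x0Y by (simp add: N\<^sub>a_def x0_adj')
  then have "nbrs (G\<^sub>1 S) (g x\<^sub>0) = nbrs G\<^sub>0 (g x\<^sub>0) \<union> {g a}"
    using x0_in unfolding G\<^sub>1_def nbrs_insert_node by simp
  also have "\<dots> = K - {g b}"
    using gK g_eq[of a b] unfolding nbrs_G0 by auto
  finally show 1: "nbrs (G\<^sub>1 S) (g x\<^sub>0) = K - {g b}" .
  have "g x\<^sub>0 \<in> N\<^sub>b j" using x0_in b x0Y by (simp add: N\<^sub>b_def x0_adj')
  then have "nbrs (G\<^sub>2 S j) (g x\<^sub>0) = nbrs (G\<^sub>1 S) (g x\<^sub>0) \<union> {g b}"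
    using x0_in unfolding G\<^sub>2_def nbrs_insert_node by simp
  then show "nbrs (G\<^sub>2 S j) (g x\<^sub>0) = K" unfolding 1 using gK(2) by blast
qed

lemma nbrs_G1_indep:
  assumes "u \<notin> Y" "u \<noteq> g a"
  shows "nbrs (G\<^sub>1 S) u = nbrs (G\<^sub>1 S') u"
  using assms by (auto simp: G\<^sub>1_def nbrs_insert_node N\<^sub>a_def)

lemma nbrs_G2_indep:
  assumes "u \<notin> Y" "u \<noteq> g b"
  shows "nbrs (G\<^sub>2 S j) u = nbrs (G\<^sub>2 S j') u"
  using assms by (auto simp: G\<^sub>2_def nbrs_insert_node N\<^sub>b_def)

lemma nbrs_G2_b: "nbrs (G\<^sub>2 S j) (g b) = N\<^sub>b j"
  using g_in[of b] by (auto simp: nbrs_def G\<^sub>2_def G\<^sub>1_def adj_insert_node adj_G0 N\<^sub>a_def N\<^sub>b_def)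

text \<open>
  The round-2 message of \<open>b\<close> does not depend on \<open>S\<close>, so the slot of \<open>b\<close> is reused for the round-1
  message of \<open>a\<close>.  The remaining round-2 messages do not depend on \<open>j\<close>, which is therefore set to \<open>0\<close>.
\<close>

definition transcript :: "algorithm \<Rightarrow> nat set \<Rightarrow> nat \<Rightarrow> message" where
  "transcript A S = (\<lambda>u\<in>K.
     if u = g b then send_msg A G\<^sub>0 (g a) [] (nbrs (G\<^sub>1 S) (g a)) (g x\<^sub>0)
     else send_msg A G\<^sub>0 u (view_after A (net S 0) 1 u) (nbrs (G\<^sub>2 S 0) u) (g x\<^sub>0))"

lemma view_after_1_indep: "view_after A (net S j) (Suc 0) = view_after A (net S j') (Suc 0)"
  by (simp add: net_def cong: if_cong)

text \<open>The neighbour lists of \<open>x\<^sub>0\<close> are fixed, so only messages from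
  \<open>K\<close> matter. In round 1 only \<open>g a\<close> can see \<open>S\<close>. In round 2
  the sender \<open>g b\<close> sees \<open>j\<close> but has no history, and the other senders do
  not see \<open>j\<close>.\<close>

lemma view_x0_cong:
  assumes eq: "transcript A S = transcript A S'"
  shows "view_after A (net S j) 2 (g x\<^sub>0) = view_after A (net S' j) 2 (g x\<^sub>0)"
proof -
  have bK: "g b \<in> K" using b by (simp add: K_def)
  have msg_a: "send_msg A G\<^sub>0 (g a) [] (nbrs (G\<^sub>1 S) (g a)) (g x\<^sub>0) =
      send_msg A G\<^sub>0 (g a) [] (nbrs (G\<^sub>1 S') (g a)) (g x\<^sub>0)"
    using fun_cong[OF eq, of "g b"] bK by (simp add: transcript_def)
  have msg1: "send_msg A G\<^sub>0 u [] (nbrs (G\<^sub>1 S) u) (g x\<^sub>0) =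
      send_msg A G\<^sub>0 u [] (nbrs (G\<^sub>1 S') u) (g x\<^sub>0)" if "u \<in> K" for u
    using msg_a nbrs_G1_indep[OF K_notin_Y[OF that], of S S'] by (cases "u = g a") auto
  have msg2: "send_msg A G\<^sub>0 u (view_after A (net S j) (Suc 0) u) (nbrs (G\<^sub>2 S j) u) (g x\<^sub>0) =
      send_msg A G\<^sub>0 u (view_after A (net S' j) (Suc 0) u) (nbrs (G\<^sub>2 S' j) u) (g x\<^sub>0)"
    if u: "u \<in> K" for u
  proof (cases "u = g b")
    case True
    have "view_after A (net Z j) (Suc 0) (g b) = []" for Z by (simp add: net_def verts_G)
    then show ?thesis using True by (simp add: nbrs_G2_b)
  next
    case False
    have "send_msg A G\<^sub>0 u (view_after A (net S 0) (Suc 0) u) (nbrs (G\<^sub>2 S 0) u) (g x\<^sub>0) =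
        send_msg A G\<^sub>0 u (view_after A (net S' 0) (Suc 0) u) (nbrs (G\<^sub>2 S' 0) u) (g x\<^sub>0)"
      using fun_cong[OF eq, of u] u False by (simp add: transcript_def del: view_after.simps)
    \<comment> \<open>The transcript is taken at \<open>j = 0\<close>; both the histories and the
      neighbour lists of these senders agree with those for the given \<open>j\<close>.\<close>
    then show ?thesis
      using nbrs_G2_indep[OF K_notin_Y[OF u] False, of _ j 0] view_after_1_indep[of A _ j 0]
      by metis
  qed
  have view1: "view_after A (net S j) (Suc 0) (g x\<^sub>0) = view_after A (net S' j) (Suc 0) (g x\<^sub>0)"
    using msg1 by (auto simp: net_def verts_G nbrs_x0 intro!: ext)
  have view2: "view_after A (net Z j) 2 (g x\<^sub>0) = view_after A (net Z j) (Suc 0) (g x\<^sub>0) @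
      [(K, \<lambda>u. if u \<in> K then Some (send_msg A G\<^sub>0 u (view_after A (net Z j) (Suc 0) u)
                 (nbrs (G\<^sub>2 Z j) u) (g x\<^sub>0)) else None)]" for Z
  proof -
    have "net Z j (Suc (Suc 0)) = G\<^sub>2 Z j" "net Z j 0 = G\<^sub>0" by (simp_all add: net_def)
    then show ?thesis
      using view_after.simps(2)[of A "net Z j" "Suc 0"] g_in[of "x\<^sub>0"]
      by (simp add: numeral_2_eq_2 verts_G nbrs_x0 del: view_after.simps cong: if_cong)
  qed
  have "(\<lambda>u. if u \<in> K then Some (send_msg A G\<^sub>0 u (view_after A (net S j) (Suc 0) u)
             (nbrs (G\<^sub>2 S j) u) (g x\<^sub>0)) else None) =
        (\<lambda>u. if u \<in> K then Some (send_msg A G\<^sub>0 u (view_after A (net S' j) (Suc 0) u)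
             (nbrs (G\<^sub>2 S' j) u) (g x\<^sub>0)) else None)"
    using msg2 by (intro ext) (simp del: view_after.simps)
  then show ?thesis unfolding view2 view1 by simp
qed

section \<open>Counting transcripts\<close>

text \<open>One transcript serves every \<open>j\<close>: letting \<open>j\<close> run through
  \<open>Y\<close>, the outputs of \<open>x\<^sub>0\<close> recover \<open>S\<close> element by
  element.\<close>

lemma transcript_inj:
  assumes solves: "one_round_solves n A (mem_detect H)"
  shows "inj_on (transcript A) (Pow Y)"
proof (rule inj_onI, rule ccontr)
  fix S S' assume SS': "S \<in> Pow Y" "S' \<in> Pow Y" "transcript A S = transcript A S'" "S \<noteq> S'"
  have out: "out_bit A G\<^sub>0 (g x\<^sub>0) (view_after A (net Z j) 2 (g x\<^sub>0)) \<longleftrightarrow>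
      mem_detect H (G\<^sub>2 Z j) (g x\<^sub>0)" for Z j
  proof -
    have G: "net Z j 2 = G\<^sub>2 Z j" "net Z j 0 = G\<^sub>0" by (simp_all add: net_def)
    then have "g x\<^sub>0 \<in> verts (net Z j 2)" using g_in[of "x\<^sub>0"] by (simp add: verts_G)
    then show ?thesis
      using solves network[of Z j] G unfolding one_round_solves_def
      by (metis one_le_numeral)
  qed
  have "mem_detect H (G\<^sub>2 S j) (g x\<^sub>0) \<longleftrightarrow> mem_detect H (G\<^sub>2 S' j) (g x\<^sub>0)" for j
    using out view_x0_cong[OF SS'(3)] by metis
  then have "j \<in> S \<longleftrightarrow> j \<in> S'" if "j \<in> Y" for j
    using mem_detect_pos[OF that] mem_detect_neg by blast
  then show False using SS' by blast
qed

lemma bandwidth_lower_bound: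
  assumes B: "has_bandwidth A B" and solves: "one_round_solves n A (mem_detect H)"
  shows "card Y \<le> card (verts H - X) * B"
proof -
  let ?M = "{xs :: message. set xs \<subseteq> UNIV \<and> length xs = B}"
  have finK: "finite K" using finite_H by (simp add: K_def)
  have cardK: "card K = card (verts H - X)"
    unfolding K_def by (intro card_image) (meson Diff_subset inj_g inj_on_subset)
  have finM: "finite ?M" by (rule finite_lists_length_eq) simp
  \<comment> \<open>Transcripts are undefined off \<open>K\<close>, so they are counted as
    extensional functions, of which there are \<open>2 ^ (B * card K)\<close>.\<close>
  have "transcript A ` Pow Y \<subseteq> K \<rightarrow>\<^sub>E ?M"
    using B by (auto simp: transcript_def has_bandwidth_def)
  moreover have "finite (K \<rightarrow>\<^sub>E ?M)" using finK finM by (intro finite_PiE) auto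
  ultimately have "card (Pow Y) \<le> card (K \<rightarrow>\<^sub>E ?M)"
    using transcript_inj[OF solves] card_inj_on_le by blast
  also have "\<dots> = card ?M ^ card K" using finK by (simp add: card_PiE)
  also have "card ?M = 2 ^ B" by (subst card_lists_length_eq) auto
  finally have "(2::nat) ^ card Y \<le> 2 ^ (B * card K)"
    by (simp add: card_Pow Y_def power_mult)
  then show ?thesis by (simp add: cardK mult.commute)
qed

end

section \<open>The asymptotic bound\<close>

text \<open>A finite infimum comes from a nonempty set and is attained by well-ordering, so bounding
  each feasible \<open>B\<close> suffices; an infinite value is trivial.\<close>

lemma ereal_le_one_round_bandwidth:
  assumes "\<And>A B. has_bandwidth A B \<Longrightarrow> one_round_solves n A P \<Longrightarrow> t \<le> real B"
  shows "ereal t \<le> ereal_of_enat (one_round_bandwidth n P)"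
proof (cases "one_round_bandwidth n P")
  case (enat B)
  let ?S = "{enat B | B. \<exists>A. has_bandwidth A B \<and> one_round_solves n A P}"
  have "?S \<noteq> {}"
    using enat unfolding one_round_bandwidth_def
    by (metis (no_types, lifting) Inf_enat_def enat.distinct(1))
  then obtain e where "e \<in> ?S" by blast
  then have "Inf ?S \<in> ?S" by (rule wellorder_InfI)
  then show ?thesis using assms enat by (auto simp: one_round_bandwidth_def)
qed simp

theorem theorem6p6:
  fixes H :: "'h ugraph"
  assumes "simple_graph H"
    and "finite (verts H)"
    and "connected_graph H"
    and "card (verts H) \<ge> 3"
    and "complete_multipartite H"
    and "\<not> is_clique H"
    and "\<not> is_star H"
  shows "\<exists>c::real. c > 0 \<and>
    (\<forall>\<^sub>F n in sequentially.
       ereal (c * real n) \<le> ereal_of_enat (one_round_bandwidth n (mem_detect H)))"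
proof -
  obtain X where X: "X \<subseteq> verts H" "card X \<ge> 2" "card (verts H - X) \<ge> 2"
    and nbrs_X: "\<And>u. u \<in> X \<Longrightarrow> nbrs H u = verts H - X"
    and deg: "\<And>w. w \<in> verts H \<Longrightarrow> card (verts H - X) \<le> card (nbrs H w)"
    using complete_multipartite_largest_part[OF assms] by metis
  obtain x\<^sub>0 y\<^sub>0 where xy: "x\<^sub>0 \<in> X" "y\<^sub>0 \<in> X" "x\<^sub>0 \<noteq> y\<^sub>0"
    using X(2) by (auto simp: card_le_Suc_iff numeral_2_eq_2)
  obtain a b where ab: "a \<in> verts H - X" "b \<in> verts H - X" "a \<noteq> b"
    using X(3) by (auto simp: card_le_Suc_iff numeral_2_eq_2)
  let ?d = "card (verts H - X)" and ?h = "card (verts H)"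
  have d: "?d > 0" using X(3) by simp
  \<comment> \<open>With \<open>n\<close> at least twice the size of \<open>H\<close>, the embedding
    \<open>g\<close> exists and more than half of the IDs are twins, which gives the factor
    2.\<close>
  have bound: "ereal (1 / (2 * real ?d) * real n) \<le>
      ereal_of_enat (one_round_bandwidth n (mem_detect H))" if n: "n \<ge> 2 * ?h" for n
  proof (rule ereal_le_one_round_bandwidth)
    fix A B assume AB: "has_bandwidth A B" "one_round_solves n A (mem_detect H)"
    obtain g where "inj_on g (verts H)" "g ` verts H \<subseteq> {1..n}"
      using inj_on_iff_card_le[OF assms(2), of "{1..n}"] n by auto
    then interpret twin_construction H X "x\<^sub>0" "y\<^sub>0" a b g n
      using assms X xy ab nbrs_X deg by unfold_locales auto
    have "n + 1 \<le> ?d * B + ?h" using bandwidth_lower_bound[OF AB] card_Y by linarith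
    then have "n \<le> 2 * (?d * B)" using n by linarith
    then have "real n \<le> 2 * (real ?d * real B)" by (metis of_nat_le_iff of_nat_mult of_nat_numeral)
    then show "1 / (2 * real ?d) * real n \<le> real B"
      using d by (simp add: field_simps)
  qed
  show ?thesis
  proof (intro exI conjI)
    show "1 / (2 * real ?d) > 0" using d by simp
    show "\<forall>\<^sub>F n in sequentially. ereal (1 / (2 * real ?d) * real n) \<le>
        ereal_of_enat (one_round_bandwidth n (mem_detect H))"
      using bound eventually_sequentially by blast
  qed
qed

end
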